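(* There exist graphs $G$ and $H$ such that $G\cong_{\mathcal S_+}H$ but not $G\cong_{\mathcal{DNN}}H$.
   Context: Graphs are finite, simple and undirected. For vertices $x,y$ of the same graph, $\mathrm{rel}(x,y)$ denotes their relationship: equal, adjacent, or distinct non-adjacent. $\mathcal S_+$ is the cone of (Hermitian) positive semidefinite matrices; $\mathcal{DNN}$ is the cone of positive semidefinite matrices with nonnegative real entries. For a cone $\mathcal K$, $G\cong_{\mathcal K}H$ means: there is a matrix $M\in\mathcal K$ with rows and columns indexed by $V_G\times V_H$ such that $\sum_{h,h'\in V_H}M_{gh,g'h'}=1$ for all $g,g'\in V_G$; $\sum_{g,g'\in V_G}M_{gh,g'h'}=1$ for all $h,h'\in V_H$; and $M_{gh,g'h'}=0$ whenever $\mathrm{rel}(g,g')\neq\mathrm{rel}(h,h')$. *)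

theory Defs
  imports Complex_Main "HOL-Library.Complex_Order" "Graph_Theory.Pair_Digraph"
begin

text \<open>
  A finite simple undirected graph is a \<^locale>\<open>pair_graph\<close>: a finite vertex set together with a
  symmetric irreflexive set of arcs, each edge being represented by its two arcs.
\<close>

datatype relationship = Equal | Adjacent | Nonadjacent

definition rel :: "'a pair_pre_digraph \<Rightarrow> 'a \<Rightarrow> 'a \<Rightarrow> relationship" where
  "rel G x y = (if x = y then Equal else if (x, y) \<in> parcs G then Adjacent else Nonadjacent)"

text \<open>
  A complex matrix with rows and columns indexed by a finite set \<open>I\<close> is a function of two indices;
  only its values on \<open>I \<times> I\<close> are ever constrained or used.  On complex numbers \<open>0 \<le> z\<close> means that
  \<open>z\<close> is real and nonnegative.
\<close>

type_synonym 'i cmatrix = "'i \<Rightarrow> 'i \<Rightarrow> complex"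

definition psd_cone :: "'i set \<Rightarrow> 'i cmatrix set" ("\<S>\<^sub>+") where
  "\<S>\<^sub>+ I = {M. (\<forall>i\<in>I. \<forall>j\<in>I. M j i = cnj (M i j)) \<and>
              (\<forall>v :: 'i \<Rightarrow> complex. 0 \<le> (\<Sum>i\<in>I. \<Sum>j\<in>I. cnj (v i) * M i j * v j))}"

definition dnn_cone :: "'i set \<Rightarrow> 'i cmatrix set" ("\<D>\<N>\<N>") where
  "\<D>\<N>\<N> I = {M \<in> \<S>\<^sub>+ I. \<forall>i\<in>I. \<forall>j\<in>I. 0 \<le> M i j}"

text \<open>
  A cone \<open>K\<close> is given as a family of sets of matrices, one for each index set.
\<close>

definition conic_iso ::
  "(('a \<times> 'b) set \<Rightarrow> ('a \<times> 'b) cmatrix set) \<Rightarrow> 'a pair_pre_digraph \<Rightarrow> 'b pair_pre_digraph \<Rightarrow> bool"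
where
  "conic_iso K G H \<longleftrightarrow>
    (\<exists>M \<in> K (pverts G \<times> pverts H).
      (\<forall>g\<in>pverts G. \<forall>g'\<in>pverts G. (\<Sum>h\<in>pverts H. \<Sum>h'\<in>pverts H. M (g, h) (g', h')) = 1) \<and>
      (\<forall>h\<in>pverts H. \<forall>h'\<in>pverts H. (\<Sum>g\<in>pverts G. \<Sum>g'\<in>pverts G. M (g, h) (g', h')) = 1) \<and>
      (\<forall>g\<in>pverts G. \<forall>g'\<in>pverts G. \<forall>h\<in>pverts H. \<forall>h'\<in>pverts H.
         rel G g g' \<noteq> rel H h h' \<longrightarrow> M (g, h) (g', h') = 0))"

end

theory Submission
  imports Defs
begin

text \<open>
  Take for \<open>G\<close> the 4-dimensional cube and for \<open>H\<close> the Hoffman graph, which is cospectral to it.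
  Both are 1-walk-regular: their spectral idempotents \<open>E\<^sub>\<theta>\<close>, \<open>F\<^sub>\<theta>\<close> are constant on the diagonal and
  on edges, with the same values for \<open>G\<close> and \<open>H\<close>. Hence the positive semidefinite matrix
  \<open>\<Sum>\<^sub>\<theta> (E\<^sub>\<theta> \<otimes> F\<^sub>\<theta>) / tr E\<^sub>\<theta>\<close> vanishes wherever the relationships differ.

  A doubly nonnegative witness induces a unital trace-preserving completely positive map \<open>\<Phi>\<close> with
  \<open>\<Phi> A\<^sub>G = A\<^sub>H\<close>. By the Kadison--Schwarz inequality \<open>\<Phi> (A\<^sub>G\<^sup>2) - A\<^sub>H\<^sup>2\<close> is positive semidefinite, and its
  diagonal is zero because both graphs have degree 4. Two non-adjacent vertices of \<open>H\<close> have three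
  common neighbours, whereas the corresponding entry of \<open>\<Phi> (A\<^sub>G\<^sup>2)\<close> is an average of entries of \<open>A\<^sub>G\<^sup>2\<close>
  at distinct non-adjacent vertices, which are at most two.
\<close>

section \<open>Preliminaries: Gram matrices are positive semidefinite\<close>

lemma sum_of_bool_mult:
  fixes f :: "'a \<Rightarrow> real"
  assumes "finite A" "x \<in> A"
  shows "(\<Sum>z\<in>A. of_bool (x = z) * f z) = f x"
proof -
  have "(\<Sum>z\<in>A. of_bool (x = z) * f z) = (\<Sum>z\<in>A. if x = z then f z else 0)"
    by (intro sum.cong) auto
  then show ?thesis
    using assms by simp
qed

lemma pair_graph_arc_sym:
  assumes "pair_graph G"
  shows "(x, y) \<in> parcs G \<longleftrightarrow> (y, x) \<in> parcs G"
  using pair_sym_digraph.arcs_symmetric[of G] assms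
  unfolding pair_graph_def pair_pseudo_graph_def by blast

text \<open>The quadratic form at \<open>v\<close> equals the sum over \<open>s\<close> of
  \<open>w s\<close> times the squared modulus of the pairing of \<open>r s\<close> with
  \<open>v\<close>. Keeping the weights apart from the vectors avoids square roots of the ratios
  \<open>c k / c t\<close>.\<close>

lemma psd_cone_gram:
  fixes r :: "'s \<Rightarrow> 'i \<Rightarrow> real"
  assumes M: "\<And>p q. p \<in> I \<Longrightarrow> q \<in> I \<Longrightarrow> M p q = complex_of_real (\<Sum>s\<in>S. w s * (r s p * r s q))"
    and w: "\<And>s. s \<in> S \<Longrightarrow> 0 \<le> w s"
  shows "M \<in> \<S>\<^sub>+ I"
proof -
  have herm: "M q p = cnj (M p q)" if "p \<in> I" "q \<in> I" for p q
    using that by (simp add: M mult.commute)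
  have "0 \<le> (\<Sum>p\<in>I. \<Sum>q\<in>I. cnj (v p) * M p q * v q)" for v
  proof -
    have "(\<Sum>p\<in>I. \<Sum>q\<in>I. cnj (v p) * M p q * v q)
        = (\<Sum>p\<in>I. \<Sum>q\<in>I. \<Sum>s\<in>S. w s * ((r s p * cnj (v p)) * (r s q * v q)))"
      by (intro sum.cong refl) (simp add: M sum_distrib_left sum_distrib_right mult_ac)
    also have "\<dots> = (\<Sum>s\<in>S. \<Sum>p\<in>I. \<Sum>q\<in>I. w s * ((r s p * cnj (v p)) * (r s q * v q)))"
      by (subst sum.swap[of _ S], intro sum.cong refl sum.swap)
    also have "\<dots> = (\<Sum>s\<in>S. w s * (cnj (\<Sum>p\<in>I. r s p * v p) * (\<Sum>q\<in>I. r s q * v q)))"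
      by (simp only: sum_product cnj_sum complex_cnj_mult complex_cnj_complex_of_real)
        (simp only: sum_distrib_left)
    also have "\<dots> = (\<Sum>s\<in>S. complex_of_real (w s * (cmod (\<Sum>p\<in>I. r s p * v p))\<^sup>2))"
      by (intro sum.cong refl)
        (simp only: of_real_mult complex_norm_square mult.commute[of "cnj _"])
    also have "\<dots> = complex_of_real (\<Sum>s\<in>S. w s * (cmod (\<Sum>p\<in>I. r s p * v p))\<^sup>2)"
      by simp
    also have "0 \<le> \<dots>"
      using w by (auto simp: less_eq_complex_def intro!: sum_nonneg)
    finally show ?thesis .
  qed
  with herm show ?thesis
    unfolding psd_cone_def by blast
qed

section \<open>Positive semidefinite isomorphism from matching spectral idempotents\<close>

text \<open>
  The matrices \<open>E t\<close> are the spectral idempotents of the adjacency matrix of \<open>G\<close>, indexed by the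
  eigenvalues \<open>t\<close>; the constant \<open>c t\<close> is the multiplicity of \<open>t\<close> divided by the number of vertices.
\<close>

locale one_walk_regular =
  fixes G :: "'a pair_pre_digraph" and k :: real and T :: "real set" and c :: "real \<Rightarrow> real"
    and E :: "real \<Rightarrow> 'a \<Rightarrow> 'a \<Rightarrow> real"
  assumes finite_spectrum: "finite T" and k: "k \<in> T" "k \<noteq> 0"
    and pos: "\<And>t. t \<in> T \<Longrightarrow> 0 < c t"
    and card: "card (pverts G) * c k = 1"
    and projection: "\<And>t x y. t \<in> T \<Longrightarrow> x \<in> pverts G \<Longrightarrow> y \<in> pverts G \<Longrightarrow>
      E t x y = (\<Sum>z\<in>pverts G. E t z x * E t z y)"
    and resolution: "\<And>x y. x \<in> pverts G \<Longrightarrow> y \<in> pverts G \<Longrightarrow> (\<Sum>t\<in>T. E t x y) = of_bool (x = y)"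
    and adjacency: "\<And>x y. x \<in> pverts G \<Longrightarrow> y \<in> pverts G \<Longrightarrow>
      (\<Sum>t\<in>T. t * E t x y) = of_bool ((x, y) \<in> parcs G)"
    and principal: "\<And>x y. x \<in> pverts G \<Longrightarrow> y \<in> pverts G \<Longrightarrow> E k x y = c k"
    and row_sum: "\<And>t x. t \<in> T \<Longrightarrow> x \<in> pverts G \<Longrightarrow> (\<Sum>y\<in>pverts G. E t x y) = of_bool (k = t)"
    and diagonal: "\<And>t x. t \<in> T \<Longrightarrow> x \<in> pverts G \<Longrightarrow> E t x x = c t"
    and edge: "\<And>t x y. t \<in> T \<Longrightarrow> x \<in> pverts G \<Longrightarrow> y \<in> pverts G \<Longrightarrow> (x, y) \<in> parcs G \<Longrightarrow>
      E t x y = t * c t / k"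
    and loopfree: "\<And>x. (x, x) \<notin> parcs G"
begin

text \<open>Used to sum one tensor factor out of the witness: only the principal eigenvalue
  survives.\<close>

lemma total_sum:
  assumes "t \<in> T"
  shows "(\<Sum>x\<in>pverts G. \<Sum>y\<in>pverts G. E t x y) * c k = of_bool (k = t)"
  using assms card by (simp add: row_sum)

text \<open>On the diagonal of \<open>G\<close> the quotient \<open>E t x x' / c t\<close> is 1, so
  the sum is an entry of the identity of \<open>H\<close>; on an edge it is \<open>t / k\<close>, so
  the sum is an entry of the adjacency matrix of \<open>H\<close> divided by \<open>k\<close>.
  Either entry vanishes when the relationships differ.\<close>

lemma contraction_zero:
  assumes x: "x \<in> pverts G" "x' \<in> pverts G" and y: "y \<in> pverts H" "y' \<in> pverts H"
    and H: "one_walk_regular H k T c F"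
    and "rel G x x' \<noteq> rel H y y'" and "rel G x x' \<noteq> Nonadjacent"
  shows "(\<Sum>t\<in>T. E t x x' * F t y y' / c t) = 0"
proof (cases "x = x'")
  case True
  then have "(\<Sum>t\<in>T. E t x x' * F t y y' / c t) = (\<Sum>t\<in>T. F t y y')"
    using pos x by (intro sum.cong refl) (fastforce simp: diagonal)
  then show ?thesis
    using assms True by (simp add: one_walk_regular.resolution[OF H] rel_def split: if_splits)
next
  case False
  with assms have arc: "(x, x') \<in> parcs G"
    by (simp add: rel_def split: if_splits)
  have "(\<Sum>t\<in>T. E t x x' * F t y y' / c t) = (\<Sum>t\<in>T. t * F t y y' / k)"
    using pos x arc by (intro sum.cong refl) (fastforce simp: edge)
  also have "\<dots> = of_bool ((y, y') \<in> parcs H) / k"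
    using y by (simp add: one_walk_regular.adjacency[OF H] flip: sum_divide_distrib)
  finally show ?thesis
    using assms False arc one_walk_regular.loopfree[OF H]
    by (auto simp: rel_def split: if_splits)
qed

end

theorem one_walk_regular_conic_iso_psd:
  assumes G: "one_walk_regular G k T c E" and H: "one_walk_regular H k T c F"
  shows "conic_iso \<S>\<^sub>+ G H"
proof -
  interpret G: one_walk_regular G k T c E by fact
  interpret H: one_walk_regular H k T c F by fact
  \<comment> \<open>Since \<open>c k\<close> is 1/n and \<open>c t\<close> is the multiplicity of
    \<open>t\<close> over n, the weight \<open>c k / c t\<close> is the reciprocal of the trace of
    \<open>E t\<close>.\<close>
  define N where "N g h g' h' = c k * (\<Sum>t\<in>T. E t g g' * F t h h' / c t)" for g h g' h'
  define M where "M = (\<lambda>(g, h) (g', h'). complex_of_real (N g h g' h'))"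
  have ck: "c k > 0" using G.pos G.k by simp
  \<comment> \<open>By \<open>projection\<close> each idempotent is the Gram matrix of its own
    columns, so the tensor product is the Gram matrix of the products of columns, indexed by
    \<open>(z, w)\<close>.\<close>
  have "M \<in> \<S>\<^sub>+ (pverts G \<times> pverts H)"
  proof (rule psd_cone_gram[where S = "T \<times> pverts G \<times> pverts H" and w = "\<lambda>(t, z, w). c k / c t"
        and r = "\<lambda>(t, z, w) (g, h). E t z g * F t w h"])
    fix p q assume "p \<in> pverts G \<times> pverts H" "q \<in> pverts G \<times> pverts H"
    then obtain g h g' h' where [simp]: "p = (g, h)" "q = (g', h')"
      and v: "g \<in> pverts G" "h \<in> pverts H" "g' \<in> pverts G" "h' \<in> pverts H" by auto
    have "N g h g' h' = (\<Sum>t\<in>T. \<Sum>z\<in>pverts G. \<Sum>w\<in>pverts H.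
        c k / c t * ((E t z g * F t w h) * (E t z g' * F t w h')))"
      unfolding N_def sum_distrib_left
    proof (intro sum.cong refl)
      fix t assume "t \<in> T"
      then have "c k * (E t g g' * F t h h' / c t) = c k / c t *
          ((\<Sum>z\<in>pverts G. E t z g * E t z g') * (\<Sum>w\<in>pverts H. F t w h * F t w h'))"
        using v by (simp flip: G.projection H.projection)
      then show "c k * (E t g g' * F t h h' / c t) = (\<Sum>z\<in>pverts G. \<Sum>w\<in>pverts H.
          c k / c t * ((E t z g * F t w h) * (E t z g' * F t w h')))"
        by (simp only: sum_product) (simp only: sum_distrib_left mult_ac)
    qed
    then show "M p q = complex_of_real (\<Sum>s\<in>T \<times> pverts G \<times> pverts H.
        (case s of (t, z, w) \<Rightarrow> c k / c t) *
        ((case s of (t, z, w) \<Rightarrow> \<lambda>(g, h). E t z g * F t w h) p *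
         (case s of (t, z, w) \<Rightarrow> \<lambda>(g, h). E t z g * F t w h) q))"
      by (simp add: M_def sum.cartesian_product case_prod_unfold)
  next
    fix s assume "s \<in> T \<times> pverts G \<times> pverts H"
    then show "0 \<le> (case s of (t, z, w) \<Rightarrow> c k / c t)"
      using ck G.pos by (auto intro!: divide_nonneg_nonneg less_imp_le)
  qed
  moreover have "(\<Sum>h\<in>pverts H. \<Sum>h'\<in>pverts H. N g h g' h') = 1"
    if "g \<in> pverts G" "g' \<in> pverts G" for g g'
  proof -
    have "(\<Sum>h\<in>pverts H. \<Sum>h'\<in>pverts H. N g h g' h') =
        (\<Sum>t\<in>T. ((\<Sum>h\<in>pverts H. \<Sum>h'\<in>pverts H. F t h h') * c k) * (E t g g' / c t))"
      unfolding N_def sum_distrib_left sum_distrib_right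
      by (subst sum.swap[of _ T], subst sum.swap[of _ T]) (intro sum.cong refl; simp add: mult_ac)
    \<comment> \<open>Only \<open>t = k\<close> is left, and there \<open>E k g g'\<close> is the
      constant \<open>c k\<close>, which cancels.\<close>
    also have "\<dots> = 1"
      using G.finite_spectrum G.k ck that
      by (simp add: H.total_sum G.principal sum_of_bool_mult del: times_divide_eq_right)
    finally show ?thesis .
  qed
  moreover have "(\<Sum>g\<in>pverts G. \<Sum>g'\<in>pverts G. N g h g' h') = 1"
    if "h \<in> pverts H" "h' \<in> pverts H" for h h'
  proof -
    have "(\<Sum>g\<in>pverts G. \<Sum>g'\<in>pverts G. N g h g' h') =
        (\<Sum>t\<in>T. ((\<Sum>g\<in>pverts G. \<Sum>g'\<in>pverts G. E t g g') * c k) * (F t h h' / c t))"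
      unfolding N_def sum_distrib_left sum_distrib_right
      by (subst sum.swap[of _ T], subst sum.swap[of _ T]) (intro sum.cong refl; simp add: mult_ac)
    also have "\<dots> = 1"
      using G.finite_spectrum G.k ck that
      by (simp add: G.total_sum H.principal sum_of_bool_mult del: times_divide_eq_right)
    finally show ?thesis .
  qed
  moreover have "N g h g' h' = 0"
    if "g \<in> pverts G" "g' \<in> pverts G" "h \<in> pverts H" "h' \<in> pverts H" "rel G g g' \<noteq> rel H h h'"
    for g h g' h'
  \<comment> \<open>Differing relationships cannot both be \<open>Nonadjacent\<close>, so
    \<open>contraction_zero\<close> applies as it stands or with the graphs exchanged.\<close>
  proof (cases "rel G g g' = Nonadjacent")
    case False
    then show ?thesis
      using G.contraction_zero[OF that(1-4) H] that unfolding N_def by simp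
  next
    case True
    then show ?thesis
      using H.contraction_zero[OF that(3,4,1,2) G] that unfolding N_def by (simp add: mult.commute)
  qed
  ultimately show ?thesis
    unfolding conic_iso_def M_def by (intro bexI[of _ M]) (simp_all add: M_def flip: of_real_sum)
qed

section \<open>A common-neighbour obstruction to doubly nonnegative isomorphism\<close>

definition common_neighbours :: "'a pair_pre_digraph \<Rightarrow> 'a \<Rightarrow> 'a \<Rightarrow> 'a set" where
  "common_neighbours G x y = {z. (x, z) \<in> parcs G \<and> (y, z) \<in> parcs G}"

text \<open>
  The matrix \<open>R\<close> is the Choi matrix of the completely positive map \<open>\<Phi>\<close> below, which sends the
  identity and the adjacency matrix of \<open>G\<close> to those of \<open>H\<close>; nonnegativity of \<open>R\<close> makes every entry
  of \<open>\<Phi> X\<close> a weighted average of entries of \<open>X\<close> of the same relationship.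
\<close>

locale dnn_witness =
  fixes G :: "'a pair_pre_digraph" and H :: "'b pair_pre_digraph"
    and R :: "'a \<Rightarrow> 'b \<Rightarrow> 'a \<Rightarrow> 'b \<Rightarrow> real" and k :: nat
  assumes G: "pair_graph G" and H: "pair_graph H"
    and regG: "\<And>x. x \<in> pverts G \<Longrightarrow> card {y. (x, y) \<in> parcs G} = k"
    and regH: "\<And>x. x \<in> pverts H \<Longrightarrow> card {y. (x, y) \<in> parcs H} = k"
    and nonneg: "\<And>g h g' h'. \<lbrakk>g \<in> pverts G; g' \<in> pverts G; h \<in> pverts H; h' \<in> pverts H\<rbrakk> \<Longrightarrow>
      0 \<le> R g h g' h'"
    and col: "\<And>h h'. \<lbrakk>h \<in> pverts H; h' \<in> pverts H\<rbrakk> \<Longrightarrow>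
      (\<Sum>g\<in>pverts G. \<Sum>g'\<in>pverts G. R g h g' h') = 1"
    and zero: "\<And>g h g' h'. \<lbrakk>g \<in> pverts G; g' \<in> pverts G; h \<in> pverts H; h' \<in> pverts H;
      rel G g g' \<noteq> rel H h h'\<rbrakk> \<Longrightarrow> R g h g' h' = 0"
    and psd: "\<And>u :: 'a \<Rightarrow> 'b \<Rightarrow> real. 0 \<le> (\<Sum>g\<in>pverts G. \<Sum>h\<in>pverts H.
      \<Sum>g'\<in>pverts G. \<Sum>h'\<in>pverts H. u g h * R g h g' h' * u g' h')"
begin

definition \<Phi> :: "('a \<Rightarrow> 'a \<Rightarrow> real) \<Rightarrow> 'b \<Rightarrow> 'b \<Rightarrow> real" where
  "\<Phi> X h h' = (\<Sum>g\<in>pverts G. \<Sum>g'\<in>pverts G. X g g' * R g h g' h')"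

lemma finite_verts [simp]: "finite (pverts G)" "finite (pverts H)"
  using G H by (auto simp: pair_graph_def pair_digraph_def pair_fin_digraph_def pair_fin_digraph_axioms_def)

text \<open>The entries \<open>R g h g' h'\<close> are nonnegative weights of total 1 supported on
  pairs of the right relationship. Entrywise nonnegativity enters the argument here.\<close>

lemma \<Phi>_le:
  assumes "h \<in> pverts H" "h' \<in> pverts H"
    and "\<And>g g'. \<lbrakk>g \<in> pverts G; g' \<in> pverts G; rel G g g' = rel H h h'\<rbrakk> \<Longrightarrow> X g g' \<le> t"
  shows "\<Phi> X h h' \<le> t"
proof -
  have "\<Phi> X h h' \<le> (\<Sum>g\<in>pverts G. \<Sum>g'\<in>pverts G. t * R g h g' h')"
    unfolding \<Phi>_def
  proof (intro sum_mono)
    fix g g' assume "g \<in> pverts G" "g' \<in> pverts G"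
    then show "X g g' * R g h g' h' \<le> t * R g h g' h'"
      using assms nonneg zero by (cases "rel G g g' = rel H h h'") (simp_all add: mult_right_mono)
  qed
  then show ?thesis
    using col assms by (simp flip: sum_distrib_left)
qed

lemma \<Phi>_eq:
  assumes "h \<in> pverts H" "h' \<in> pverts H"
    and "\<And>g g'. \<lbrakk>g \<in> pverts G; g' \<in> pverts G; rel G g g' = rel H h h'\<rbrakk> \<Longrightarrow> X g g' = t"
  shows "\<Phi> X h h' = t"
proof -
  have "\<Phi> X h h' = (\<Sum>g\<in>pverts G. \<Sum>g'\<in>pverts G. t * R g h g' h')"
    unfolding \<Phi>_def
  proof (intro sum.cong refl)
    fix g g' assume "g \<in> pverts G" "g' \<in> pverts G"
    then show "X g g' * R g h g' h' = t * R g h g' h'"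
      using assms zero by (cases "rel G g g' = rel H h h'") simp_all
  qed
  then show ?thesis
    using col assms by (simp flip: sum_distrib_left)
qed

abbreviation A :: "'a \<Rightarrow> 'a \<Rightarrow> real" where "A x y \<equiv> of_bool ((x, y) \<in> parcs G)"
abbreviation B :: "'b \<Rightarrow> 'b \<Rightarrow> real" where "B x y \<equiv> of_bool ((x, y) \<in> parcs H)"

lemma loopfree: "(x, x) \<notin> parcs G" "(y, y) \<notin> parcs H"
  using pair_loopfree_digraph.pair_no_loops[of G "(x, x)"] pair_loopfree_digraph.pair_no_loops[of H "(y, y)"]
    G H unfolding pair_graph_def pair_digraph_def by auto

lemmas sym = pair_graph_arc_sym[OF G] pair_graph_arc_sym[OF H]

lemma in_verts: "(x, y) \<in> parcs G \<Longrightarrow> y \<in> pverts G" "(v, w) \<in> parcs H \<Longrightarrow> w \<in> pverts H"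
  using pair_wf_digraph.in_arcsD2[of G x y] pair_wf_digraph.in_arcsD2[of H v w] G H
  unfolding pair_graph_def pair_pseudo_graph_def pair_sym_digraph_def by auto

lemma adjacency_square:
  "(\<Sum>z\<in>pverts G. A x z * A y z) = card (common_neighbours G x y)"
  "(\<Sum>z\<in>pverts H. B v z * B w z) = card (common_neighbours H v w)"
proof -
  have "pverts G \<inter> {z. (x, z) \<in> parcs G \<and> (y, z) \<in> parcs G} = common_neighbours G x y"
    "pverts H \<inter> {z. (v, z) \<in> parcs H \<and> (w, z) \<in> parcs H} = common_neighbours H v w"
    using in_verts by (auto simp: common_neighbours_def)
  then show "(\<Sum>z\<in>pverts G. A x z * A y z) = card (common_neighbours G x y)"
    "(\<Sum>z\<in>pverts H. B v z * B w z) = card (common_neighbours H v w)"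
    by (simp_all flip: of_bool_conj)
qed

lemma \<Phi>_adjacency: "h \<in> pverts H \<Longrightarrow> h' \<in> pverts H \<Longrightarrow> \<Phi> A h h' = B h h'"
  by (rule \<Phi>_eq) (auto simp: rel_def loopfree split: if_splits)

lemma \<Phi>_identity: "h \<in> pverts H \<Longrightarrow> h' \<in> pverts H \<Longrightarrow> \<Phi> (\<lambda>x y. of_bool (x = y)) h h' = of_bool (h = h')"
  by (rule \<Phi>_eq) (auto simp: rel_def split: if_splits)

text \<open>The Kadison--Schwarz inequality for \<open>\<Phi>\<close> at the adjacency matrix.\<close>

lemma schwarz:
  fixes v :: "'b \<Rightarrow> real"
  shows "(\<Sum>h\<in>pverts H. \<Sum>h'\<in>pverts H. v h * v h' * card (common_neighbours H h h'))
    \<le> (\<Sum>h\<in>pverts H. \<Sum>h'\<in>pverts H. v h * v h' * \<Phi> (\<lambda>x y. card (common_neighbours G x y)) h h')"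
proof -
  define w where "w h = (\<Sum>h'\<in>pverts H. B h' h * v h')" for h
  define X :: "'a \<Rightarrow> 'a \<Rightarrow> real" where "X = (\<lambda>x y. card (common_neighbours G x y))"
  \<comment> \<open>With \<open>w = B v\<close>, the vectors \<open>u z\<close> are the slices of A
    \<otimes> v - I \<otimes> w. Summing the form of \<open>R\<close> over them completes a square:
    the result is v\<cdot>\<Phi>(A^2)v - 2 w\<cdot>\<Phi>(A)v + w\<cdot>\<Phi>(I)w.\<close>
  define u :: "'a \<Rightarrow> 'a \<Rightarrow> 'b \<Rightarrow> real"
    where "u z g h = A g z * v h - of_bool (g = z) * w h" for z g h
  have u: "(\<Sum>z\<in>pverts G. u z g h * u z g' h') = v h * v h' * X g g'
      - v h * w h' * A g g' - w h * v h' * A g g' + w h * w h' * of_bool (g = g')"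
    if "g \<in> pverts G" "g' \<in> pverts G" for g h g' h'
  proof -
    have "u z g h * u z g' h' = v h * v h' * (A g z * A g' z) - v h * w h' * (of_bool (g' = z) * A g z)
       - w h * v h' * (of_bool (g = z) * A g' z) + w h * w h' * (of_bool (g = z) * of_bool (g' = z))" for z
      unfolding u_def by (simp add: algebra_simps)
    then show ?thesis
      using that
      by (simp only: sum.distrib sum_subtractf flip: sum_distrib_left)
        (simp add: adjacency_square X_def sym(1)[of g' g] sum_of_bool_mult)
  qed
  have "0 \<le> (\<Sum>z\<in>pverts G. \<Sum>g\<in>pverts G. \<Sum>h\<in>pverts H. \<Sum>g'\<in>pverts G. \<Sum>h'\<in>pverts H.
      u z g h * R g h g' h' * u z g' h')"
    by (intro sum_nonneg psd)
  also have "\<dots> = (\<Sum>h\<in>pverts H. \<Sum>h'\<in>pverts H. \<Sum>g\<in>pverts G. \<Sum>g'\<in>pverts G. \<Sum>z\<in>pverts G.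
      u z g h * R g h g' h' * u z g' h')"
    unfolding sum.cartesian_product
    by (rule sum.reindex_bij_witness[where i = "\<lambda>(h, h', g, g', z). (z, g, h, g', h')"
          and j = "\<lambda>(z, g, h, g', h'). (h, h', g, g', z)"]) auto
  also have "\<dots> = (\<Sum>h\<in>pverts H. \<Sum>h'\<in>pverts H. \<Sum>g\<in>pverts G. \<Sum>g'\<in>pverts G.
      (\<Sum>z\<in>pverts G. u z g h * u z g' h') * R g h g' h')"
    unfolding sum_distrib_right by (simp only: mult_ac)
  also have "\<dots> = (\<Sum>h\<in>pverts H. \<Sum>h'\<in>pverts H. v h * v h' * \<Phi> X h h'
     - v h * w h' * \<Phi> A h h' - w h * v h' * \<Phi> A h h' + w h * w h' * \<Phi> (\<lambda>x y. of_bool (x = y)) h h')"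
    unfolding \<Phi>_def sum_distrib_left
    by (intro sum.cong refl) (simp add: u algebra_simps sum.distrib sum_subtractf)
  \<comment> \<open>As \<Phi> sends A to B and I to I, both cross terms and the last term equal
    w\<cdot>w, with total coefficient -1.\<close>
  also have "\<dots> = (\<Sum>h\<in>pverts H. \<Sum>h'\<in>pverts H. v h * v h' * \<Phi> X h h')
     - (\<Sum>h\<in>pverts H. w h * w h)"
  proof -
    have "(\<Sum>h\<in>pverts H. \<Sum>h'\<in>pverts H. v h * w h' * B h h') = (\<Sum>h'\<in>pverts H. w h' * w h')"
      by (subst sum.swap, intro sum.cong refl)
        (simp only: w_def[of h' for h'] sum_distrib_left mult_ac)
    moreover have "(\<Sum>h\<in>pverts H. \<Sum>h'\<in>pverts H. w h * v h' * B h h') = (\<Sum>h\<in>pverts H. w h * w h)"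
      by (intro sum.cong refl) (simp only: w_def[of h for h] sum_distrib_left sym(2) mult_ac)
    moreover have "(\<Sum>h\<in>pverts H. \<Sum>h'\<in>pverts H. w h * w h' * of_bool (h = h')) = (\<Sum>h\<in>pverts H. w h * w h)"
      by (simp only: mult.commute[of _ "of_bool _"] sum_of_bool_mult finite_verts cong: sum.cong)
    ultimately show ?thesis
      by (simp add: \<Phi>_adjacency \<Phi>_identity sum.distrib sum_subtractf)
  qed
  also have "(\<Sum>h\<in>pverts H. w h * w h) =
     (\<Sum>h\<in>pverts H. \<Sum>h'\<in>pverts H. v h * v h' * card (common_neighbours H h h'))"
  proof -
    have "(\<Sum>z\<in>pverts H. w z * w z) =
        (\<Sum>z\<in>pverts H. \<Sum>h\<in>pverts H. \<Sum>h'\<in>pverts H. v h * v h' * (B h z * B h' z))"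
      unfolding w_def sum_product by (simp only: mult_ac)
    also have "\<dots> = (\<Sum>h\<in>pverts H. \<Sum>h'\<in>pverts H. \<Sum>z\<in>pverts H. v h * v h' * (B h z * B h' z))"
      by (subst sum.swap, intro sum.cong refl sum.swap)
    finally show ?thesis
      by (simp only: adjacency_square flip: sum_distrib_left)
  qed
  finally show ?thesis by (simp add: X_def)
qed

lemma card_common_neighbours_le:
  assumes ab: "a \<in> pverts H" "b \<in> pverts H" "rel H a b = Nonadjacent"
    and c: "\<And>x y. \<lbrakk>x \<in> pverts G; y \<in> pverts G; rel G x y = Nonadjacent\<rbrakk> \<Longrightarrow>
      card (common_neighbours G x y) \<le> c"
  shows "card (common_neighbours H a b) \<le> c"
proof -
  \<comment> \<open>The test vector is the sum of the unit vectors at \<open>a\<close> and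
    \<open>b\<close>. The diagonal entries on both sides of \<open>schwarz\<close> are all
    \<open>k\<close> and cancel, leaving only the entries at \<open>(a, b)\<close> and
    \<open>(b, a)\<close>.\<close>
  define v :: "'b \<Rightarrow> real" where "v h = of_bool (a = h) + of_bool (b = h)" for h
  let ?Y = "\<lambda>x y. real (card (common_neighbours G x y))"
  have expand: "(\<Sum>h\<in>pverts H. \<Sum>h'\<in>pverts H. v h * v h' * Z h h') = Z a a + Z a b + Z b a + Z b b"
    for Z :: "'b \<Rightarrow> 'b \<Rightarrow> real"
  proof -
    have "v h * v h' * Z h h' = of_bool (a = h) * (of_bool (a = h') * Z h h')
        + of_bool (a = h) * (of_bool (b = h') * Z h h') + of_bool (b = h) * (of_bool (a = h') * Z h h')
        + of_bool (b = h) * (of_bool (b = h') * Z h h')" for h h'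
      by (simp only: v_def algebra_simps)
    then show ?thesis
      using ab by (simp only: sum.distrib sum_of_bool_mult finite_verts flip: sum_distrib_left)
  qed
  have diag: "\<Phi> ?Y h h = k" "card (common_neighbours H h h) = k" if "h \<in> pverts H" for h
    using that by (auto intro!: \<Phi>_eq simp: rel_def common_neighbours_def regG regH split: if_splits)
  have rels: "rel H b a = Nonadjacent" "common_neighbours H b a = common_neighbours H a b"
    using ab sym by (auto simp: rel_def common_neighbours_def split: if_splits)
  have "\<Phi> ?Y a b \<le> c" "\<Phi> ?Y b a \<le> c"
    using ab rels c by (auto intro!: \<Phi>_le)
  with schwarz[of v] show ?thesis
    using ab by (simp add: expand diag rels)
qed

end


theorem dnn_conic_iso_card_common_neighbours_le:
  assumes "pair_graph G" "pair_graph H" and iso: "conic_iso \<D>\<N>\<N> G H"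
    and "\<And>x. x \<in> pverts G \<Longrightarrow> card {y. (x, y) \<in> parcs G} = k"
    and "\<And>x. x \<in> pverts H \<Longrightarrow> card {y. (x, y) \<in> parcs H} = k"
    and "\<And>x y. \<lbrakk>x \<in> pverts G; y \<in> pverts G; rel G x y = Nonadjacent\<rbrakk> \<Longrightarrow>
      card (common_neighbours G x y) \<le> c"
    and "a \<in> pverts H" "b \<in> pverts H" "rel H a b = Nonadjacent"
  shows "card (common_neighbours H a b) \<le> c"
proof -
  obtain M where M: "M \<in> \<D>\<N>\<N> (pverts G \<times> pverts H)"
    and col: "\<And>h h'. h \<in> pverts H \<Longrightarrow> h' \<in> pverts H \<Longrightarrow>
      (\<Sum>g\<in>pverts G. \<Sum>g'\<in>pverts G. M (g, h) (g', h')) = 1"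
    and zero: "\<And>g h g' h'. \<lbrakk>g \<in> pverts G; g' \<in> pverts G; h \<in> pverts H; h' \<in> pverts H;
      rel G g g' \<noteq> rel H h h'\<rbrakk> \<Longrightarrow> M (g, h) (g', h') = 0"
    using iso unfolding conic_iso_def by blast
  \<comment> \<open>Entries of a doubly nonnegative matrix are real, so nothing is lost; real test
    vectors suffice for \<open>dnn_witness\<close>.\<close>
  define R where "R g h g' h' = Re (M (g, h) (g', h'))" for g h g' h'
  have R: "M (g, h) (g', h') = complex_of_real (R g h g' h')" and nonneg: "0 \<le> R g h g' h'"
    if "g \<in> pverts G" "g' \<in> pverts G" "h \<in> pverts H" "h' \<in> pverts H" for g h g' h'
    using M that unfolding R_def dnn_cone_def by (force simp: less_eq_complex_def complex_eq_iff)+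
  have psd: "0 \<le> (\<Sum>g\<in>pverts G. \<Sum>h\<in>pverts H. \<Sum>g'\<in>pverts G. \<Sum>h'\<in>pverts H.
      u g h * R g h g' h' * u g' h')" for u
  proof -
    have "0 \<le> (\<Sum>p\<in>pverts G \<times> pverts H. \<Sum>q\<in>pverts G \<times> pverts H.
        cnj (complex_of_real (case p of (g, h) \<Rightarrow> u g h)) * M p q * complex_of_real (case q of (g, h) \<Rightarrow> u g h))"
      using M unfolding dnn_cone_def psd_cone_def
      by (simp only: mem_Collect_eq)
    also have "\<dots> = complex_of_real (\<Sum>g\<in>pverts G. \<Sum>h\<in>pverts H. \<Sum>g'\<in>pverts G. \<Sum>h'\<in>pverts H.
      u g h * R g h g' h' * u g' h')"
      by (simp add: R sum.cartesian_product')
    finally show ?thesis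
      by (simp add: less_eq_complex_def)
  qed
  have colR: "(\<Sum>g\<in>pverts G. \<Sum>g'\<in>pverts G. R g h g' h') = 1" if "h \<in> pverts H" "h' \<in> pverts H" for h h'
    using col[OF that] unfolding R_def by (simp flip: Re_sum)
  have zeroR: "R g h g' h' = 0"
    if "g \<in> pverts G" "g' \<in> pverts G" "h \<in> pverts H" "h' \<in> pverts H" "rel G g g' \<noteq> rel H h h'"
    for g h g' h'
    using zero[OF that] by (simp add: R_def)
  have "dnn_witness G H R k"
    by (rule dnn_witness.intro[OF assms(1,2,4,5) nonneg colR zeroR psd])
  from dnn_witness.card_common_neighbours_le[OF this assms(7,8,9,6)] show ?thesis .
qed

section \<open>Spectral idempotents of graphs with the spectrum of the 4-cube\<close>

text \<open>
  With \<open>J\<close> the all-ones matrix and \<open>W = s s\<^sup>T\<close>, the cubic condition reads \<open>A\<^sup>3 = 4 A + 3 J - 3 W\<close>,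
  so the adjacency algebra is spanned by \<open>I, A, A\<^sup>2, J, W\<close>; below, \<open>L a b c d e\<close> is
  \<open>a I + b A + c A\<^sup>2 + d J + e W\<close>.
\<close>

locale hypercube_spectrum =
  fixes G :: "'a pair_pre_digraph" and s :: "'a \<Rightarrow> real"
  assumes graph: "pair_graph G" and card16: "card (pverts G) = 16"
    and sign: "\<And>x. s x * s x = 1"
    and balanced: "(\<Sum>x\<in>pverts G. s x) = 0"
    and alternating: "\<And>x y. (x, y) \<in> parcs G \<Longrightarrow> s y = - s x"
    and regular: "\<And>x. x \<in> pverts G \<Longrightarrow> (\<Sum>y\<in>pverts G. of_bool ((x, y) \<in> parcs G)) = (4 :: real)"
    and cubic: "\<And>x y. x \<in> pverts G \<Longrightarrow> y \<in> pverts G \<Longrightarrow>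
      (\<Sum>z\<in>pverts G. of_bool ((x, z) \<in> parcs G) *
        (\<Sum>w\<in>pverts G. of_bool ((z, w) \<in> parcs G) * of_bool ((w, y) \<in> parcs G)))
      = 4 * of_bool ((x, y) \<in> parcs G) + 3 - 3 * (s x * s y)"
begin

abbreviation V where "V \<equiv> pverts G"

definition A :: "'a \<Rightarrow> 'a \<Rightarrow> real" where "A x y = of_bool ((x, y) \<in> parcs G)"

definition A2 :: "'a \<Rightarrow> 'a \<Rightarrow> real" where "A2 x y = (\<Sum>z\<in>V. A x z * A z y)"

definition L :: "real \<Rightarrow> real \<Rightarrow> real \<Rightarrow> real \<Rightarrow> real \<Rightarrow> 'a \<Rightarrow> 'a \<Rightarrow> real" where
  "L a b c d e x y = a * of_bool (x = y) + b * A x y + c * A2 x y + d + e * (s x * s y)"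

lemma finite_V [simp]: "finite V"
  using card16 card.infinite by fastforce

lemma A_sym: "A x y = A y x"
  unfolding A_def using pair_graph_arc_sym[OF graph, of x y] by simp

lemma A2_sym: "A2 x y = A2 y x"
  unfolding A2_def by (simp add: A_sym[of x] A_sym[of _ y] mult.commute)

lemma L_sym: "L a b c d e x y = L a b c d e y x"
  unfolding L_def using A_sym[of x y] A2_sym[of x y] by (simp add: mult.commute eq_commute)

lemma A_sign: "A x z * s z = - s x * A x z"
  using alternating by (auto simp: A_def)

lemma row_A: "x \<in> V \<Longrightarrow> (\<Sum>z\<in>V. A x z) = 4"
  using regular by (simp add: A_def)

text \<open>Multiply term by term: AJ = 4J by regularity, AW = -4W because signs alternate along
  arcs, and A times A^2 is given by \<open>cubic\<close>.\<close>

lemma A_L: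
  assumes "x \<in> V" "y \<in> V"
  shows "(\<Sum>z\<in>V. A x z * L a b c d e z y) = L 0 (a + 4 * c) b (4 * d + 3 * c) (- 4 * e - 3 * c) x y"
proof -
  have "A x z * L a b c d e z y = a * (of_bool (y = z) * A x z) + b * (A x z * A z y) + c * (A x z * A2 z y)
      + d * A x z - e * (s x * s y) * A x z" for z
    using arg_cong[OF A_sign[of x z], of "\<lambda>u. e * s y * u"] by (simp add: L_def algebra_simps eq_commute)
  then have "(\<Sum>z\<in>V. A x z * L a b c d e z y) = a * A x y + b * A2 x y + c * (\<Sum>z\<in>V. A x z * A2 z y)
      + d * 4 - e * (s x * s y) * 4"
    using assms by (simp only: sum.distrib sum_subtractf sum_of_bool_mult finite_V row_A A2_def
        flip: sum_distrib_left)
  also have "(\<Sum>z\<in>V. A x z * A2 z y) = 4 * A x y + 3 - 3 * (s x * s y)"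
    using cubic[OF assms] by (simp add: A_def A2_def)
  finally show ?thesis
    by (simp add: L_def algebra_simps)
qed

lemma A2_mult: "(\<Sum>z\<in>V. A2 x z * f z) = (\<Sum>w\<in>V. A x w * (\<Sum>z\<in>V. A w z * f z))"
  unfolding A2_def sum_distrib_left sum_distrib_right by (subst sum.swap) (simp add: mult.assoc)

lemma A2_L:
  assumes "x \<in> V" "y \<in> V"
  shows "(\<Sum>z\<in>V. A2 x z * L a b c d e z y)
    = L 0 (4 * b) (a + 4 * c) (16 * d + 12 * c + 3 * b) (16 * e + 12 * c - 3 * b) x y"
  using assms by (simp add: A2_mult A_L algebra_simps cong: sum.cong)

text \<open>The all-ones vector and \<open>s\<close> (in \<open>sign_L\<close>) are eigenvectors of
  A for 4 and -4, orthogonal by \<open>balanced\<close>; hence J and W absorb every \<open>L\<close>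
  up to a scalar.\<close>

lemma one_L:
  assumes "y \<in> V"
  shows "(\<Sum>z\<in>V. L a b c d e z y) = a + 4 * b + 16 * c + 16 * d"
proof -
  have A2_row: "(\<Sum>z\<in>V. A2 y z) = 16"
    using assms A2_mult[of y "\<lambda>_. 1"] by (simp add: row_A flip: sum_distrib_right cong: sum.cong)
  have "L a b c d e z y = of_bool (y = z) * a + b * A y z + c * A2 y z + d + (e * s y) * s z" for z
    using A_sym[of y z] A2_sym[of y z] by (simp add: L_def algebra_simps eq_commute)
  then show ?thesis
    using assms
    by (simp only: sum.distrib sum_of_bool_mult finite_V row_A A2_row balanced flip: sum_distrib_left)
      (simp add: card16)
qed

lemma sign_L:
  assumes "y \<in> V"
  shows "(\<Sum>z\<in>V. s x * s z * L a b c d e z y) = (a - 4 * b + 16 * c + 16 * e) * (s x * s y)"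
proof -
  have A: "(\<Sum>z\<in>V. A y z * s z) = - 4 * s y" if "y \<in> V" for y
    using that by (simp add: A_sign row_A sum_negf flip: sum_distrib_left)
  have A2: "(\<Sum>z\<in>V. A2 y z * s z) = 16 * s y"
  proof -
    have "(\<Sum>z\<in>V. A2 y z * s z) = (\<Sum>z\<in>V. (- 4) * (A y z * s z))"
      unfolding A2_mult by (intro sum.cong refl) (simp add: A)
    then show ?thesis
      using A[OF assms] by (simp only: flip: sum_distrib_left)
  qed
  have "s x * s z * L a b c d e z y = (a * s x) * (of_bool (y = z) * s z) + (b * s x) * (A y z * s z)
      + (c * s x) * (A2 y z * s z) + (d * s x) * s z + (e * (s x * s y)) * (s z * s z)" for z
    using A_sym[of y z] A2_sym[of y z] by (simp add: L_def algebra_simps eq_commute)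
  then show ?thesis
    using assms
    by (simp only: sum.distrib sum_of_bool_mult finite_V A A2 balanced flip: sum_distrib_left)
      (simp add: card16 sign algebra_simps)
qed

text \<open>This multiplication table reduces idempotency to arithmetic on five
  coefficients.\<close>

lemma L_L:
  assumes "x \<in> V" "y \<in> V"
  shows "(\<Sum>z\<in>V. L a b c d e x z * L a' b' c' d' e' z y) =
    L (a * a') (a * b' + b * a' + 4 * (b * c' + c * b')) (a * c' + c * a' + b * b' + 4 * c * c')
      (a * d' + d * a' + 4 * (b * d' + d * b') + 3 * (b * c' + c * b')
        + 12 * c * c' + 16 * (c * d' + d * c') + 16 * d * d')
      (a * e' + e * a' - 4 * (b * e' + e * b') - 3 * (b * c' + c * b')
        + 12 * c * c' + 16 * (c * e' + e * c') + 16 * e * e') x y"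
proof -
  define K where "K = L a' b' c' d' e'"
  have "(\<Sum>z\<in>V. L a b c d e x z * K z y) = (\<Sum>z\<in>V. a * (of_bool (x = z) * K z y) + b * (A x z * K z y)
      + c * (A2 x z * K z y) + d * K z y + e * (s x * s z * K z y))"
    by (intro sum.cong refl) (simp add: L_def[of a] algebra_simps)
  also have "\<dots> = a * K x y + b * (\<Sum>z\<in>V. A x z * K z y)
      + c * (\<Sum>z\<in>V. A2 x z * K z y) + d * (\<Sum>z\<in>V. K z y) + e * (\<Sum>z\<in>V. s x * s z * K z y)"
    using assms by (simp only: sum.distrib sum_of_bool_mult finite_V flip: sum_distrib_left)
  finally show ?thesis
    using assms unfolding K_def by (simp add: A_L A2_L one_L sign_L) (simp add: L_def algebra_simps)
qed

text \<open>J/16 and W/16 project onto the eigenspaces of 4 and -4. For the other \<open>t\<close>,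
  take the Lagrange polynomial for the nodes 2, 0, -2 in A and subtract its values at 4 and -4 times
  these two projections.\<close>

definition idempotent :: "real \<Rightarrow> 'a \<Rightarrow> 'a \<Rightarrow> real" where
  "idempotent t =
    (if t = 4 then L 0 0 0 (1/16) 0
     else if t = 2 then L 0 (1/4) (1/8) (-3/16) (-1/16)
     else if t = 0 then L 1 0 (-1/4) (3/16) (3/16)
     else if t = -2 then L 0 (-1/4) (1/8) (-1/16) (-3/16)
     else L 0 0 0 0 (1/16))"

lemma A2_diag: "x \<in> V \<Longrightarrow> A2 x x = 4"
  using row_A[of x] unfolding A2_def by (simp only: A_sym[of _ x]) (simp add: A_def flip: of_bool_conj)

text \<open>The graph is bipartite: a walk of length two joins vertices of equal sign, an arc joins
  opposite ones.\<close>

lemma A2_arc: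
  assumes "(x, y) \<in> parcs G" shows "A2 x y = 0"
proof -
  have "A x z * A z y = 0" for z
    using alternating[of x z] alternating[of z y] alternating[OF assms] sign[of x] by (auto simp: A_def)
  then show ?thesis unfolding A2_def by (intro sum.neutral ballI)
qed

lemma arc_loopfree: "(x, x) \<notin> parcs G"
  using alternating[of x x] sign[of x] by auto

text \<open>The eigenvalues 4, 2, 0, -2, -4 have multiplicities 1, 4, 6, 4, 1; division by 16 gives
  the diagonal constants.\<close>

lemma one_walk_regular:
  "one_walk_regular G 4 {4, 2, 0, -2, -4}
     (\<lambda>t. if t = 0 then 3/8 else if t = 2 \<or> t = -2 then 1/4 else 1/16) idempotent"
proof
  fix t x y assume t: "t \<in> {4, 2, 0, -2, -4 :: real}" and xy: "x \<in> V" "y \<in> V"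
  have "(\<Sum>z\<in>V. idempotent t z x * idempotent t z y) = (\<Sum>z\<in>V. idempotent t x z * idempotent t z y)"
    using t by (auto simp: idempotent_def L_sym[of _ _ _ _ _ _ x])
  also have "\<dots> = idempotent t x y"
    using t xy by (auto simp: idempotent_def L_L)
  finally show "idempotent t x y = (\<Sum>z\<in>V. idempotent t z x * idempotent t z y)" ..
  {
    assume "(x, y) \<in> parcs G"
    moreover from this have "s y = - s x" "x \<noteq> y"
      using alternating arc_loopfree by auto
    ultimately show "idempotent t x y = t * (if t = 0 then 3/8 else if t = 2 \<or> t = -2 then 1/4 else 1/16) / 4"
      using t sign[of x] by (auto simp: idempotent_def L_def A2_arc A_def)
  }
next
  fix t x assume t: "t \<in> {4, 2, 0, -2, -4 :: real}" and x: "x \<in> V"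
  show "idempotent t x x = (if t = 0 then 3/8 else if t = 2 \<or> t = -2 then 1/4 else 1/16)"
    using t x by (auto simp: idempotent_def L_def A2_diag sign A_def arc_loopfree)
  have "(\<Sum>y\<in>V. idempotent t x y) = (\<Sum>y\<in>V. idempotent t y x)"
    using t by (auto simp: idempotent_def L_sym[of _ _ _ _ _ x])
  also have "\<dots> = of_bool (4 = t)"
    using t x by (auto simp: idempotent_def one_L)
  finally show "(\<Sum>y\<in>V. idempotent t x y) = of_bool (4 = t)" .
next
  fix x y
  show "(\<Sum>t\<in>{4, 2, 0, -2, -4}. idempotent t x y) = of_bool (x = y)"
    by (simp add: idempotent_def L_def algebra_simps)
  show "(\<Sum>t\<in>{4, 2, 0, -2, -4}. t * idempotent t x y) = of_bool ((x, y) \<in> parcs G)"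
    by (simp add: idempotent_def L_def A_def algebra_simps)
  show "idempotent 4 x y = (if 4 = (0::real) then 3/8 else if 4 = (2::real) \<or> 4 = (-2::real) then 1/4 else 1/16)"
    by (simp add: idempotent_def L_def)
qed (auto simp: card16 arc_loopfree)

end

section \<open>The 4-cube and the Hoffman graph as adjacency lists\<close>

definition adj_graph :: "nat list list \<Rightarrow> nat pair_pre_digraph" where
  "adj_graph N = \<lparr>pverts = {..<length N}, parcs = {(x, y). x < length N \<and> y \<in> set (N ! x)}\<rparr>"

text \<open>The list holds the 4-bit words with an even number of ones. This is a colour class of
  the cube, and the switching that yields the Hoffman graph preserves it.\<close>

definition even_weight :: "nat \<Rightarrow> bool" where
  "even_weight x \<longleftrightarrow> x \<in> set [0, 3, 5, 6, 9, 10, 12, 15]"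

definition weight_sign :: "nat \<Rightarrow> real" where
  "weight_sign x = (if even_weight x then 1 else - 1)"

definition bipartite_quartic :: "nat list list \<Rightarrow> bool" where
  "bipartite_quartic N \<longleftrightarrow> length N = 16 \<and>
    (\<forall>x\<in>{0..<16}. distinct (N ! x) \<and> length (N ! x) = 4 \<and>
      (\<forall>y\<in>set (N ! x). y < 16 \<and> x \<in> set (N ! y) \<and> even_weight y = (\<not> even_weight x)))"

text \<open>The cubic relation of \<^locale>\<open>hypercube_spectrum\<close>, applied to a vector \<open>f\<close>.\<close>

definition cubic_relation :: "nat list list \<Rightarrow> bool" where
  "cubic_relation N \<longleftrightarrow> (\<forall>x<16. \<forall>f :: nat \<Rightarrow> real.
    (\<Sum>z\<leftarrow>N ! x. \<Sum>w\<leftarrow>N ! z. \<Sum>v\<leftarrow>N ! w. f v) = 4 * (\<Sum>v\<leftarrow>N ! x. f v)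
      + 3 * (\<Sum>v\<leftarrow>[0..<16]. f v) - 3 * weight_sign x * (\<Sum>v\<leftarrow>[0..<16]. weight_sign v * f v))"

lemma pair_graph_adj_graph:
  assumes "\<And>x y. x < length N \<Longrightarrow> y \<in> set (N ! x) \<Longrightarrow> y < length N \<and> x \<in> set (N ! y) \<and> y \<noteq> x"
  shows "pair_graph (adj_graph N)"
proof -
  let ?G = "adj_graph N"
  have arc: "x \<in> pverts ?G \<and> y \<in> pverts ?G \<and> x \<noteq> y" and rev: "(y, x) \<in> parcs ?G"
    if "(x, y) \<in> parcs ?G" for x y
    using that assms[of x y] by (simp_all add: adj_graph_def)
  have fin: "finite (pverts ?G)"
    by (simp add: adj_graph_def)
  have "parcs ?G \<subseteq> pverts ?G \<times> pverts ?G"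
    using arc by auto
  then have "finite (parcs ?G)"
    using fin by (blast intro: finite_subset)
  moreover have "symmetric (with_proj ?G)"
    unfolding symmetric_def with_proj_simps using rev by (intro symI)
  ultimately show ?thesis
    using fin arc by unfold_locales auto
qed

lemma bipartite_quarticD:
  assumes "bipartite_quartic N"
  shows "length N = 16"
    and "x < 16 \<Longrightarrow> distinct (N ! x)"
    and "x < 16 \<Longrightarrow> length (N ! x) = 4"
    and "x < 16 \<Longrightarrow> y \<in> set (N ! x) \<Longrightarrow> y < 16 \<and> x \<in> set (N ! y) \<and> even_weight y = (\<not> even_weight x)"
  using assms unfolding bipartite_quartic_def by (meson atLeastLessThan_iff zero_le)+

lemma bipartite_quartic_graph:
  assumes "bipartite_quartic N"
  shows "pair_graph (adj_graph N)"
  by (rule pair_graph_adj_graph) (use bipartite_quarticD[OF assms] in metis)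

lemma hypercube_spectrum_adj_graph:
  assumes N: "bipartite_quartic N" and "cubic_relation N"
  shows "hypercube_spectrum (adj_graph N) weight_sign"
proof (rule hypercube_spectrum.intro)
  note len = bipartite_quarticD(1)[OF N] and row = bipartite_quarticD(2,3)[OF N]
    and nbr = bipartite_quarticD(4)[OF N]
  let ?A = "\<lambda>x y. of_bool ((x, y) \<in> parcs (adj_graph N)) :: real"
  have A: "?A x y = of_bool (y \<in> set (N ! x))" if "x < 16" for x y
    using that by (simp add: adj_graph_def len)
  have nbr_sum: "(\<Sum>z\<in>{..<16}. ?A x z * f z) = (\<Sum>z\<leftarrow>N ! x. f z)" if "x < 16" for x f
  proof -
    have "(\<Sum>z\<in>{..<16}. of_bool (z \<in> set (N ! x)) * f z) = (\<Sum>z\<in>set (N ! x). f z)"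
      using nbr[OF that] by (intro sum.mono_neutral_cong_right) auto
    then show ?thesis
      using row that by (simp only: A sum_list_distinct_conv_sum_set)
  qed
  show "pair_graph (adj_graph N)"
    using N by (rule bipartite_quartic_graph)
  show "card (pverts (adj_graph N)) = 16"
    by (simp add: adj_graph_def len)
  show "(\<Sum>x\<in>pverts (adj_graph N). weight_sign x) = 0"
    by (simp add: adj_graph_def len weight_sign_def even_weight_def eval_nat_numeral lessThan_Suc)
  show "weight_sign x * weight_sign x = 1" for x
    by (simp add: weight_sign_def)
  show "weight_sign y = - weight_sign x" if "(x, y) \<in> parcs (adj_graph N)" for x y
    using that nbr[of x y] by (simp add: adj_graph_def len weight_sign_def)
  fix x assume "x \<in> pverts (adj_graph N)"
  then have x: "x < 16"
    by (simp add: adj_graph_def len)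
  show "(\<Sum>y\<in>pverts (adj_graph N). ?A x y) = 4"
    using nbr_sum[OF x, of "\<lambda>_. 1"] row(2)[OF x] by (simp add: adj_graph_def len sum_list_triv)
  fix y assume "y \<in> pverts (adj_graph N)"
  then have y: "y < 16"
    by (simp add: adj_graph_def len)
  \<comment> \<open>Writing the last factor as a list sum turns the matrix entry into
    \<open>cubic_relation\<close> with \<open>f\<close> the indicator of \<open>y\<close>.\<close>
  have column: "?A w y = (\<Sum>v\<leftarrow>N ! w. of_bool (y = v))" if "w < 16" for w
    using y sum_of_bool_mult[of "{..<16}" y "?A w"] by (simp only: flip: nbr_sum[OF that]) (simp add: mult.commute)
  have "(\<Sum>z\<in>{..<16}. ?A x z * (\<Sum>w\<in>{..<16}. ?A z w * ?A w y))
      = (\<Sum>z\<in>{..<16}. ?A x z * (\<Sum>w\<in>{..<16}. ?A z w * (\<Sum>v\<leftarrow>N ! w. of_bool (y = v))))"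
    by (intro sum.cong refl arg_cong2[where f = "(*)"]) (simp only: column lessThan_iff)
  also have "\<dots> = (\<Sum>z\<in>{..<16}. ?A x z * (\<Sum>w\<leftarrow>N ! z. \<Sum>v\<leftarrow>N ! w. of_bool (y = v)))"
    by (intro sum.cong refl arg_cong2[where f = "(*)"]) (simp only: nbr_sum lessThan_iff)
  also have "\<dots> = 4 * (\<Sum>v\<leftarrow>N ! x. of_bool (y = v)) + 3 * (\<Sum>v\<leftarrow>[0..<16]. of_bool (y = v))
      - 3 * weight_sign x * (\<Sum>v\<leftarrow>[0..<16]. weight_sign v * of_bool (y = v))"
    using \<open>cubic_relation N\<close> x unfolding nbr_sum[OF x] cubic_relation_def by blast
  also have "(\<Sum>v\<leftarrow>[0..<16]. of_bool (y = v)) = (1 :: real)"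
    using y sum_of_bool_mult[of "{0..<16}" y "\<lambda>_. 1"] by (simp add: interv_sum_list_conv_sum_set_nat)
  also have "(\<Sum>v\<leftarrow>[0..<16]. weight_sign v * of_bool (y = v)) = weight_sign y"
    using y sum_of_bool_mult[of "{0..<16}" y weight_sign]
    by (simp add: interv_sum_list_conv_sum_set_nat mult.commute)
  finally show "(\<Sum>z\<in>pverts (adj_graph N). ?A x z * (\<Sum>w\<in>pverts (adj_graph N). ?A z w * ?A w y))
      = 4 * ?A x y + 3 - 3 * (weight_sign x * weight_sign y)"
    using x by (simp only: column) (simp add: adj_graph_def len)
qed

text \<open>Vertices are 4-bit words; neighbours differ in one bit.\<close>

definition cube :: "nat list list" where
  "cube =
    [[1, 2, 4, 8], [0, 3, 5, 9], [0, 3, 6, 10], [1, 2, 7, 11],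
     [0, 5, 6, 12], [1, 4, 7, 13], [2, 4, 7, 14], [3, 5, 6, 15],
     [0, 9, 10, 12], [1, 8, 11, 13], [2, 8, 11, 14], [3, 9, 10, 15],
     [4, 8, 13, 14], [5, 9, 12, 15], [6, 10, 12, 15], [7, 11, 13, 14]]"

text \<open>The Hoffman graph, obtained from the cube by Godsil--McKay switching of the neighbours
  1, 2, 4, 8 of 0: each of the six vertices with two neighbours among them gets the other two instead.\<close>

definition hoffman :: "nat list list" where
  "hoffman =
    [[1, 2, 4, 8], [0, 6, 10, 12], [0, 5, 9, 12], [4, 8, 7, 11],
     [0, 3, 9, 10], [2, 8, 7, 13], [1, 8, 7, 14], [3, 5, 6, 15],
     [0, 3, 5, 6], [2, 4, 11, 13], [1, 4, 11, 14], [3, 9, 10, 15],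
     [1, 2, 13, 14], [5, 9, 12, 15], [6, 10, 12, 15], [7, 11, 13, 14]]"

lemma bipartite_quartic_cube: "bipartite_quartic cube"
  and bipartite_quartic_hoffman: "bipartite_quartic hoffman"
  by code_simp+

lemma upt_16: "[0..<16] = [0, 1, 2, 3, 4, 5, 6, 7, 8, 9, 10, 11, 12, 13, 14, 15]"
  by (simp add: eval_nat_numeral)

lemma less_16_cases:
  assumes "x < 16"
  shows "x \<in> {0, 1, 2, 3, 4, 5, 6, 7, 8, 9, 10, 11, 12, 13, 14, 15 :: nat}"
  using assms by (auto simp: eval_nat_numeral less_Suc_eq)

text \<open>For fixed \<open>x\<close> both sides are linear forms in the unknowns
  \<open>f 0\<close> to \<open>f 15\<close>, so simplification compares all coefficients of a row at
  once: 16 cases instead of 256 entries.\<close>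

lemma cubic_relation_cube: "cubic_relation cube"
  unfolding cubic_relation_def
  by (intro allI impI, drule less_16_cases, simp only: insert_iff empty_iff, elim disjE)
    (simp_all add: cube_def weight_sign_def even_weight_def upt_16)

lemma cubic_relation_hoffman: "cubic_relation hoffman"
  unfolding cubic_relation_def
  by (intro allI impI, drule less_16_cases, simp only: insert_iff empty_iff, elim disjE)
    (simp_all add: hoffman_def weight_sign_def even_weight_def upt_16)

lemma bipartite_quartic_degree:
  assumes "bipartite_quartic N" "x \<in> pverts (adj_graph N)"
  shows "card {y. (x, y) \<in> parcs (adj_graph N)} = 4"
  using assms(2) bipartite_quarticD(1)[OF assms(1)] bipartite_quarticD(2,3)[OF assms(1), of x]
  by (simp add: adj_graph_def distinct_card)

lemma common_neighbours_adj_graph: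
  assumes "x < length N" "y < length N"
  shows "common_neighbours (adj_graph N) x y = set (N ! x) \<inter> set (N ! y)"
  using assms by (auto simp: common_neighbours_def adj_graph_def)

text \<open>Words at distance two have two common neighbours, words at distance three or four
  none.\<close>

lemma cube_common_neighbours:
  assumes "x \<in> pverts (adj_graph cube)" "y \<in> pverts (adj_graph cube)" "rel (adj_graph cube) x y = Nonadjacent"
  shows "card (common_neighbours (adj_graph cube) x y) \<le> 2"
proof -
  have "\<forall>x\<in>{0..<16}. \<forall>y\<in>{0..<16}.
      x \<noteq> y \<longrightarrow> y \<notin> set (cube ! x) \<longrightarrow> card (set (cube ! x) \<inter> set (cube ! y)) \<le> 2"
    by code_simp
  moreover have len: "length cube = 16"
    by (simp add: cube_def)
  moreover have "x < 16" "y < 16" "x \<noteq> y" "y \<notin> set (cube ! x)"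
    using assms len by (auto simp: adj_graph_def rel_def split: if_splits)
  ultimately show ?thesis
    by (simp add: common_neighbours_adj_graph)
qed

text \<open>7 and 8 are antipodal in the cube; the switching replaced the neighbours 9, 10, 12 of 8
  by 3, 5, 6, which are neighbours of 7.\<close>

lemma hoffman_common_neighbours: "card (common_neighbours (adj_graph hoffman) 7 8) = 3"
proof -
  have "common_neighbours (adj_graph hoffman) 7 8 = {3, 5, 6}"
    by (subst common_neighbours_adj_graph) (auto simp: hoffman_def)
  then show ?thesis by simp
qed

theorem theorem7p1:
  shows "\<exists>(G :: nat pair_pre_digraph) (H :: nat pair_pre_digraph).
    pair_graph G \<and> pair_graph H \<and> conic_iso \<S>\<^sub>+ G H \<and> \<not> conic_iso \<D>\<N>\<N> G H"
proof (intro exI conjI)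
  show G: "pair_graph (adj_graph cube)" and H: "pair_graph (adj_graph hoffman)"
    using bipartite_quartic_cube bipartite_quartic_hoffman by (simp_all add: bipartite_quartic_graph)
  show "conic_iso \<S>\<^sub>+ (adj_graph cube) (adj_graph hoffman)"
    by (rule one_walk_regular_conic_iso_psd[OF
          hypercube_spectrum.one_walk_regular[OF hypercube_spectrum_adj_graph[OF bipartite_quartic_cube cubic_relation_cube]]
          hypercube_spectrum.one_walk_regular[OF hypercube_spectrum_adj_graph[OF bipartite_quartic_hoffman cubic_relation_hoffman]]])
  show "\<not> conic_iso \<D>\<N>\<N> (adj_graph cube) (adj_graph hoffman)"
  proof
    assume iso: "conic_iso \<D>\<N>\<N> (adj_graph cube) (adj_graph hoffman)"
    have "card (common_neighbours (adj_graph hoffman) 7 8) \<le> 2"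
      by (rule dnn_conic_iso_card_common_neighbours_le[OF G H iso bipartite_quartic_degree[OF bipartite_quartic_cube]
            bipartite_quartic_degree[OF bipartite_quartic_hoffman] cube_common_neighbours])
        (simp_all add: adj_graph_def rel_def hoffman_def)
    then show False
      by (simp add: hoffman_common_neighbours)
  qed
qed

end
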